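(* Let $M$ be an $n$-dimensional manifold, $n>2$, and let $(g,\xi:=grad(f),\lambda,\mu)$ be a gradient $\eta$-Ricci soliton on $M$ with $\eta=df$ the $g$-dual $1$-form of $\xi$ and $\mu\neq 0$. If $\gamma$ is a $1$-form on $M$, then $\gamma$ is orthogonal to $\eta$ if and only if $$\nabla_{\gamma^{\sharp}}\xi+Q\gamma^{\sharp}+\lambda\gamma^{\sharp}=0;$$ hence, in this case, $$\tfrac12\gamma^{\sharp}(|\xi|^2)=-\gamma(Q\xi).$$
   Context: $g$ is a Riemannian metric on $M$, $f\in C^\infty(M)$, $\nabla$ the Levi-Civita connection, $S$ the Ricci tensor, $Q$ the Ricci operator, $g(QX,Y)=S(X,Y)$. The gradient $\eta$-Ricci soliton condition is $L_{\xi}g+2S+2\lambda g+2\mu\,\eta\otimes\eta=0$ with $\xi=grad(f)$, $\eta=df$, $\lambda,\mu$ real constants. $\gamma^{\sharp}$ is the vector field with $g(\gamma^{\sharp},\cdot)=\gamma$. Two $1$-forms $\gamma_1,\gamma_2$ are orthogonal if $g(\gamma_1^{\sharp},\gamma_2^{\sharp})=0$ on $M$. *)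

theory Defs
  imports "HOL-Analysis.Analysis" "HOL-Library.Function_Algebras"
begin

section \<open>Smooth maps between Euclidean spaces\<close>

text \<open>Only used on open sets \<open>U\<close> of a finite-dimensional space, where \<open>f\<close> is of class
  \<open>C\<^sup>k\<^sup>+\<^sup>1\<close> iff it is differentiable and all its directional derivatives are of class \<open>C\<^sup>k\<close>.\<close>

primrec Ck_on :: "nat \<Rightarrow> ('a::euclidean_space \<Rightarrow> 'b::real_normed_vector) \<Rightarrow> 'a set \<Rightarrow> bool" where
  "Ck_on 0 f U \<longleftrightarrow> continuous_on U f"
| "Ck_on (Suc k) f U \<longleftrightarrow> (\<forall>x\<in>U. f differentiable (at x)) \<and>
     (\<forall>v. Ck_on k (\<lambda>x. frechet_derivative f (at x) v) U)"

definition smooth_on :: "'a::euclidean_space set \<Rightarrow> ('a \<Rightarrow> 'b::real_normed_vector) \<Rightarrow> bool" where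
  "smooth_on U f \<longleftrightarrow> (\<forall>k. Ck_on k f U)"


section \<open>Smooth manifolds\<close>

text \<open>The underlying space of the manifold is a whole type \<open>'m\<close>; its dimension is \<open>CARD('n)\<close>.
  A chart is a pair of its domain and its coordinate map (whose values outside the domain are
  irrelevant). The Hausdorff and second countability axioms are imposed as type classes.\<close>

type_synonym ('m, 'n) chart = "'m set \<times> ('m \<Rightarrow> real ^ 'n)"

abbreviation dom_of :: "('m, 'n) chart \<Rightarrow> 'm set" where "dom_of \<equiv> fst"

abbreviation coord :: "('m, 'n) chart \<Rightarrow> 'm \<Rightarrow> real ^ 'n" where "coord \<equiv> snd"

definition range_of :: "('m, 'n) chart \<Rightarrow> (real ^ 'n) set" where
  "range_of c = coord c ` dom_of c"

definition param :: "('m, 'n) chart \<Rightarrow> real ^ 'n \<Rightarrow> 'm" where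
  "param c = inv_into (dom_of c) (coord c)"

definition smooth_manifold ::
    "('m::{t2_space, second_countable_topology}, 'n::finite) chart set \<Rightarrow> bool" where
  "smooth_manifold A \<longleftrightarrow>
     (\<Union>c\<in>A. dom_of c) = UNIV \<and>
     (\<forall>c\<in>A. open (dom_of c) \<and> open (range_of c) \<and>
        homeomorphism (dom_of c) (range_of c) (coord c) (param c)) \<and>
     (\<forall>c\<in>A. \<forall>d\<in>A. smooth_on (coord c ` (dom_of c \<inter> dom_of d)) (coord d \<circ> param c))"

definition charts_at :: "('m, 'n) chart set \<Rightarrow> 'm \<Rightarrow> ('m, 'n) chart set" where
  "charts_at A p = {c \<in> A. p \<in> dom_of c}"

text \<open>An arbitrary chart around \<open>p\<close>, for notions that do not depend on the chart.\<close>

definition chart_at :: "('m, 'n) chart set \<Rightarrow> 'm \<Rightarrow> ('m, 'n) chart" where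
  "chart_at A p = (SOME c. c \<in> charts_at A p)"

definition smooth_fun :: "('m, 'n::finite) chart set \<Rightarrow> ('m \<Rightarrow> real) \<Rightarrow> bool" where
  "smooth_fun A h \<longleftrightarrow> (\<forall>c\<in>A. smooth_on (range_of c) (h \<circ> param c))"


section \<open>Tangent vectors and vector fields\<close>

text \<open>A tangent vector at \<open>p\<close> is given by its components in all charts around \<open>p\<close>, related by the
  Jacobians of the coordinate changes. The value \<open>0\<close> for all other charts is a convention making
  equality of tangent vectors coincide with equality of functions.\<close>

type_synonym ('m, 'n) tvec = "('m, 'n) chart \<Rightarrow> real ^ 'n"

definition tangent_space :: "('m, 'n::finite) chart set \<Rightarrow> 'm \<Rightarrow> ('m, 'n) tvec set" where
  "tangent_space A p =
     {v. (\<forall>c \<in> charts_at A p. \<forall>d \<in> charts_at A p.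
            v d = frechet_derivative (coord d \<circ> param c) (at (coord c p)) (v c)) \<and>
         (\<forall>c. c \<notin> charts_at A p \<longrightarrow> v c = 0)}"

text \<open>The tangent vector at \<open>p\<close> with components \<open>w\<close> in the chart \<open>c\<close>.\<close>

definition tvec_of :: "('m, 'n::finite) chart set \<Rightarrow> ('m, 'n) chart \<Rightarrow> 'm \<Rightarrow> real ^ 'n \<Rightarrow> ('m, 'n) tvec"
  where
  "tvec_of A c p w =
     (\<lambda>d. if d \<in> charts_at A p
           then frechet_derivative (coord d \<circ> param c) (at (coord c p)) w else 0)"

type_synonym ('m, 'n) vfield = "'m \<Rightarrow> ('m, 'n) tvec"

definition comp_in :: "('m, 'n) chart \<Rightarrow> ('m, 'n) vfield \<Rightarrow> real ^ 'n \<Rightarrow> real ^ 'n" where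
  "comp_in c X = (\<lambda>x. X (param c x) c)"

definition vector_fields :: "('m, 'n::finite) chart set \<Rightarrow> ('m, 'n) vfield set" where
  "vector_fields A =
     {X. (\<forall>p. X p \<in> tangent_space A p) \<and> (\<forall>c\<in>A. smooth_on (range_of c) (comp_in c X))}"

text \<open>Addition, subtraction and zero of tangent vectors and vector fields are the pointwise ones
  of function types.\<close>

definition vscale :: "('m \<Rightarrow> real) \<Rightarrow> ('m, 'n::finite) vfield \<Rightarrow> ('m, 'n) vfield" (infixr "\<odot>" 75) where
  "h \<odot> X = (\<lambda>p c. h p *\<^sub>R X p c)"

type_synonym ('m, 'n) form1 = "'m \<Rightarrow> ('m, 'n) tvec \<Rightarrow> real"

definition one_form :: "('m, 'n::finite) chart set \<Rightarrow> ('m, 'n) form1 \<Rightarrow> bool" where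
  "one_form A \<gamma> \<longleftrightarrow>
     (\<forall>p. \<forall>u\<in>tangent_space A p. \<forall>v\<in>tangent_space A p. \<forall>a.
        \<gamma> p (u + v) = \<gamma> p u + \<gamma> p v \<and> \<gamma> p (\<lambda>c. a *\<^sub>R u c) = a * \<gamma> p u) \<and>
     (\<forall>c\<in>A. \<forall>w. smooth_on (range_of c) (\<lambda>x. \<gamma> (param c x) (tvec_of A c (param c x) w)))"

definition differential :: "('m, 'n::finite) chart set \<Rightarrow> ('m \<Rightarrow> real) \<Rightarrow> ('m, 'n) form1" where
  "differential A h p v =
     (let c = chart_at A p in frechet_derivative (h \<circ> param c) (at (coord c p)) (v c))"

text \<open>The function \<open>X(h)\<close>.\<close>

definition deriv_along ::
    "('m, 'n::finite) chart set \<Rightarrow> ('m, 'n) vfield \<Rightarrow> ('m \<Rightarrow> real) \<Rightarrow> 'm \<Rightarrow> real" where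
  "deriv_along A X h = (\<lambda>p. differential A h p (X p))"

definition bracket ::
    "('m, 'n::finite) chart set \<Rightarrow> ('m, 'n) vfield \<Rightarrow> ('m, 'n) vfield \<Rightarrow> ('m, 'n) vfield" where
  "bracket A X Y =
     (\<lambda>p c. if c \<in> charts_at A p
       then frechet_derivative (comp_in c Y) (at (coord c p)) (X p c)
          - frechet_derivative (comp_in c X) (at (coord c p)) (Y p c)
       else 0)"


section \<open>Riemannian metrics\<close>

type_synonym ('m, 'n) metric = "'m \<Rightarrow> ('m, 'n) tvec \<Rightarrow> ('m, 'n) tvec \<Rightarrow> real"

definition riemannian_metric :: "('m, 'n::finite) chart set \<Rightarrow> ('m, 'n) metric \<Rightarrow> bool" where
  "riemannian_metric A g \<longleftrightarrow>
     (\<forall>p. \<forall>u\<in>tangent_space A p. \<forall>v\<in>tangent_space A p. \<forall>w\<in>tangent_space A p. \<forall>a.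
        g p u v = g p v u \<and>
        g p (u + v) w = g p u w + g p v w \<and>
        g p (\<lambda>c. a *\<^sub>R u c) v = a * g p u v \<and>
        (u \<noteq> 0 \<longrightarrow> 0 < g p u u)) \<and>
     (\<forall>c\<in>A. \<forall>v w. smooth_on (range_of c)
        (\<lambda>x. g (param c x) (tvec_of A c (param c x) v) (tvec_of A c (param c x) w)))"

definition pairing :: "('m, 'n) metric \<Rightarrow> ('m, 'n) vfield \<Rightarrow> ('m, 'n) vfield \<Rightarrow> 'm \<Rightarrow> real" where
  "pairing g X Y = (\<lambda>p. g p (X p) (Y p))"

definition sharp ::
    "('m, 'n::finite) chart set \<Rightarrow> ('m, 'n) metric \<Rightarrow> ('m, 'n) form1 \<Rightarrow> ('m, 'n) vfield" where
  "sharp A g \<gamma> =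
     (THE G. G \<in> vector_fields A \<and> (\<forall>p. \<forall>v\<in>tangent_space A p. g p (G p) v = \<gamma> p v))"

definition grad ::
    "('m, 'n::finite) chart set \<Rightarrow> ('m, 'n) metric \<Rightarrow> ('m \<Rightarrow> real) \<Rightarrow> ('m, 'n) vfield" where
  "grad A g h = sharp A g (differential A h)"

definition orthogonal_forms ::
    "('m, 'n::finite) chart set \<Rightarrow> ('m, 'n) metric \<Rightarrow> ('m, 'n) form1 \<Rightarrow> ('m, 'n) form1 \<Rightarrow> bool" where
  "orthogonal_forms A g \<gamma>\<^sub>1 \<gamma>\<^sub>2 \<longleftrightarrow> (\<forall>p. pairing g (sharp A g \<gamma>\<^sub>1) (sharp A g \<gamma>\<^sub>2) p = 0)"

text \<open>The Lie derivative \<open>(L\<^sub>Z g)(X, Y)\<close>.\<close>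

definition lie_metric ::
    "('m, 'n::finite) chart set \<Rightarrow> ('m, 'n) metric \<Rightarrow>
     ('m, 'n) vfield \<Rightarrow> ('m, 'n) vfield \<Rightarrow> ('m, 'n) vfield \<Rightarrow> 'm \<Rightarrow> real" where
  "lie_metric A g Z X Y =
     deriv_along A Z (pairing g X Y) - pairing g (bracket A Z X) Y - pairing g X (bracket A Z Y)"


section \<open>Levi-Civita connection and Ricci curvature\<close>

type_synonym ('m, 'n) connection = "('m, 'n) vfield \<Rightarrow> ('m, 'n) vfield \<Rightarrow> ('m, 'n) vfield"

definition affine_connection :: "('m, 'n::finite) chart set \<Rightarrow> ('m, 'n) connection \<Rightarrow> bool" where
  "affine_connection A nabla \<longleftrightarrow>
     (\<forall>X\<in>vector_fields A. \<forall>Y\<in>vector_fields A. \<forall>Z\<in>vector_fields A. \<forall>h. smooth_fun A h \<longrightarrow>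
        nabla X Y \<in> vector_fields A \<and>
        nabla (X + Y) Z = nabla X Z + nabla Y Z \<and>
        nabla (h \<odot> X) Y = h \<odot> nabla X Y \<and>
        nabla X (Y + Z) = nabla X Y + nabla X Z \<and>
        nabla X (h \<odot> Y) = h \<odot> nabla X Y + deriv_along A X h \<odot> Y)"

text \<open>By the fundamental theorem of Riemannian geometry these conditions determine \<open>nabla\<close>
  uniquely on vector fields.\<close>

definition levi_civita ::
    "('m, 'n::finite) chart set \<Rightarrow> ('m, 'n) metric \<Rightarrow> ('m, 'n) connection \<Rightarrow> bool" where
  "levi_civita A g nabla \<longleftrightarrow>
     affine_connection A nabla \<and>
     (\<forall>X\<in>vector_fields A. \<forall>Y\<in>vector_fields A. nabla X Y - nabla Y X = bracket A X Y) \<and>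
     (\<forall>X\<in>vector_fields A. \<forall>Y\<in>vector_fields A. \<forall>Z\<in>vector_fields A.
        deriv_along A X (pairing g Y Z) = pairing g (nabla X Y) Z + pairing g Y (nabla X Z))"

definition curvature ::
    "('m, 'n::finite) chart set \<Rightarrow> ('m, 'n) connection \<Rightarrow>
     ('m, 'n) vfield \<Rightarrow> ('m, 'n) vfield \<Rightarrow> ('m, 'n) vfield \<Rightarrow> ('m, 'n) vfield" where
  "curvature A nabla X Y Z =
     nabla X (nabla Y Z) - nabla Y (nabla X Z) - nabla (bracket A X Y) Z"

text \<open>\<open>S(Y, Z)\<close> at \<open>p\<close> is the trace of the endomorphism \<open>X\<^sub>p \<mapsto> (R(X, Y)Z)\<^sub>p\<close> of the tangent space.
  The endomorphism is read in a chart; it is well defined since the curvature is tensorial and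
  every tangent vector extends to a global vector field.\<close>

definition ricci ::
    "('m, 'n::finite) chart set \<Rightarrow> ('m, 'n) connection \<Rightarrow>
     ('m, 'n) vfield \<Rightarrow> ('m, 'n) vfield \<Rightarrow> 'm \<Rightarrow> real" where
  "ricci A nabla Y Z p =
     (let c = chart_at A p in
      trace (matrix (THE T. linear T \<and>
        (\<forall>X\<in>vector_fields A. T (X p c) = curvature A nabla X Y Z p c))))"

definition ricci_op ::
    "('m, 'n::finite) chart set \<Rightarrow> ('m, 'n) metric \<Rightarrow> ('m, 'n) connection \<Rightarrow>
     ('m, 'n) vfield \<Rightarrow> ('m, 'n) vfield" where
  "ricci_op A g nabla X =
     (THE W. W \<in> vector_fields A \<and> (\<forall>Y\<in>vector_fields A. pairing g W Y = ricci A nabla X Y))"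

text \<open>The soliton equation for \<open>\<xi> = grad f\<close> and \<open>\<eta> = df\<close>.\<close>

definition gradient_eta_ricci_soliton ::
    "('m, 'n::finite) chart set \<Rightarrow> ('m, 'n) metric \<Rightarrow> ('m, 'n) connection \<Rightarrow>
     ('m \<Rightarrow> real) \<Rightarrow> real \<Rightarrow> real \<Rightarrow> bool" where
  "gradient_eta_ricci_soliton A g nabla f lam mu \<longleftrightarrow>
     (\<forall>X\<in>vector_fields A. \<forall>Y\<in>vector_fields A. \<forall>p.
        lie_metric A g (grad A g f) X Y p + 2 * ricci A nabla X Y p
          + 2 * lam * pairing g X Y p
          + 2 * mu * differential A f p (X p) * differential A f p (Y p) = 0)"

end

theory Submission
  imports Defs
begin

text \<open>Since \<open>\<xi>\<close> is a gradient, its Hessian \<open>g(\<nabla>\<^bsub>X\<^esub> \<xi>, Y)\<close> is symmetric, so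
  \<open>L\<^bsub>\<xi>\<^esub> g = 2 g(\<nabla>\<xi>, \<cdot>)\<close> and the soliton equation reads
  \<open>\<nabla>\<^bsub>X\<^esub> \<xi> + Q X + \<lambda> X = - \<mu> \<eta>(X) \<xi>\<close>. For \<open>X = \<gamma>\<^sup>\<sharp>\<close> the right-hand side vanishes iff
  \<open>\<eta>(X) = 0\<close>, because \<open>\<eta>(X) = g(\<xi>, X)\<close> vanishes wherever \<open>\<xi>\<close> does. Pairing with \<open>\<xi>\<close>
  gives the second claim. The analytic input is the existence of \<open>\<gamma>\<^sup>\<sharp>\<close> as a smooth field, by
  Cramer's rule for the Gram matrix in a chart, and the symmetry of second derivatives, which yields
  \<open>[X, Y] f = X (Y f) - Y (X f)\<close>.\<close>

section \<open>Smooth maps on open sets\<close>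

lemma Ck_on_Suc_has_derivative:
  assumes "Ck_on (Suc k) f U" "x \<in> U"
  shows "(f has_derivative frechet_derivative f (at x)) (at x)"
  using assms frechet_derivative_works by auto

text \<open>Derivatives at a point of an open set depend only on nearby values. This matters because
  \<open>param c\<close> is arbitrary outside \<open>range_of c\<close>.\<close>

lemma Ck_on_cong:
  assumes "open U" "\<And>x. x \<in> U \<Longrightarrow> f x = g x" "Ck_on k f U"
  shows "Ck_on k g U"
  using assms(2,3)
proof (induction k arbitrary: f g)
  case 0
  then show ?case using continuous_on_cong[of U U f g] by simp
next
  case (Suc k)
  have "(g has_derivative frechet_derivative f (at x)) (at x)" if "x \<in> U" for x
    using has_derivative_transform_within_open[OF Ck_on_Suc_has_derivative[OF Suc.prems(2) that]]
      \<open>open U\<close> that Suc.prems(1) by blast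
  then have *: "g differentiable (at x)"
      "frechet_derivative f (at x) = frechet_derivative g (at x)" if "x \<in> U" for x
    using that differentiableI frechet_derivative_at by blast+
  have "Ck_on k (\<lambda>x. frechet_derivative g (at x) v) U" for v
    by (rule Suc.IH[of "\<lambda>x. frechet_derivative f (at x) v"]) (use Suc.prems * in auto)
  with * show ?case by auto
qed

text \<open>Uniqueness of derivatives allows an explicit formula \<open>f'\<close> in place of
  \<open>frechet_derivative\<close>; the calculus rules below all enter through this form.\<close>

lemma Ck_on_SucI:
  assumes "open U" "\<And>x. x \<in> U \<Longrightarrow> (f has_derivative f' x) (at x)"
    and "\<And>v. Ck_on k (\<lambda>x. f' x v) U"
  shows "Ck_on (Suc k) f U"
proof -
  have "Ck_on k (\<lambda>x. frechet_derivative f (at x) v) U" for v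
    by (rule Ck_on_cong[OF \<open>open U\<close> _ assms(3)[of v]])
      (metis assms(2) frechet_derivative_at)
  then show ?thesis using assms(2) by (auto intro: differentiableI)
qed

text \<open>Differentiability gives continuity in the base case. The product and inverse rules rely
  on this to regard an undifferentiated factor as a map of lower order.\<close>

lemma Ck_on_SucD: "Ck_on (Suc k) f U \<Longrightarrow> Ck_on k f U"
proof (induction k arbitrary: f)
  case 0
  then show ?case
    by (auto intro!: continuous_at_imp_continuous_on differentiable_imp_continuous_within)
next
  case (Suc k)
  from Suc.prems have "\<forall>x\<in>U. f differentiable (at x)"
    "Ck_on (Suc k) (\<lambda>x. frechet_derivative f (at x) v) U" for v
    unfolding Ck_on.simps(2)[of "Suc k"] by blast+
  with Suc.IH show ?case unfolding Ck_on.simps(2)[of k] by blast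
qed

lemma Ck_on_const: "Ck_on k (\<lambda>x. c) U"
  by (induction k arbitrary: c) auto

lemma Ck_on_add:
  assumes "open U" "Ck_on k f U" "Ck_on k g U"
  shows "Ck_on k (\<lambda>x. f x + g x) U"
  using assms(2,3)
proof (induction k arbitrary: f g)
  case 0
  then show ?case by (auto intro: continuous_intros)
next
  case (Suc k)
  show ?case
  proof (rule Ck_on_SucI[OF \<open>open U\<close>])
    show "((\<lambda>x. f x + g x) has_derivative
        (\<lambda>v. frechet_derivative f (at x) v + frechet_derivative g (at x) v)) (at x)"
      if "x \<in> U" for x
      using that Suc.prems by (intro has_derivative_add Ck_on_Suc_has_derivative)
    show "Ck_on k (\<lambda>x. frechet_derivative f (at x) v + frechet_derivative g (at x) v) U" for v
      using Suc by auto
  qed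
qed

text \<open>Induction through the Leibniz rule. Stating it for any bounded bilinear product covers
  multiplication, scaling and the inner product at once.\<close>

lemma (in bounded_bilinear) Ck_on:
  assumes "open U" "Ck_on k f U" "Ck_on k g U"
  shows "Ck_on k (\<lambda>x. prod (f x) (g x)) U"
  using assms(2,3)
proof (induction k arbitrary: f g)
  case 0
  then show ?case by (auto intro: continuous_on)
next
  case (Suc k)
  show ?case
  proof (rule Ck_on_SucI[OF \<open>open U\<close>])
    show "((\<lambda>x. prod (f x) (g x)) has_derivative
        (\<lambda>v. prod (f x) (frechet_derivative g (at x) v) +
              prod (frechet_derivative f (at x) v) (g x))) (at x)"
      if "x \<in> U" for x
      using that Suc.prems by (intro FDERIV Ck_on_Suc_has_derivative)
    show "Ck_on k (\<lambda>x. prod (f x) (frechet_derivative g (at x) v) +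
        prod (frechet_derivative f (at x) v) (g x)) U" for v
      using Suc.prems
      by (intro Ck_on_add[OF \<open>open U\<close>] Suc.IH Ck_on_SucD[of k f] Ck_on_SucD[of k g]) auto
  qed
qed

text \<open>The derivative of \<open>1 / f\<close> is a product of \<open>1 / f\<close>, twice, and
  the derivative of \<open>f\<close>, so order \<open>k\<close> of these factors gives order
  \<open>k + 1\<close> of the inverse.\<close>

lemma Ck_on_inverse:
  fixes f :: "'a::euclidean_space \<Rightarrow> real"
  assumes "open U" "Ck_on k f U" and nz: "\<And>x. x \<in> U \<Longrightarrow> f x \<noteq> 0"
  shows "Ck_on k (\<lambda>x. inverse (f x)) U"
  using assms(2)
proof (induction k)
  case 0
  then show ?case using nz by (auto intro: continuous_intros)
next
  case (Suc k)
  show ?case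
  proof (rule Ck_on_SucI[OF \<open>open U\<close>])
    show "((\<lambda>x. inverse (f x)) has_derivative
        (\<lambda>v. - (inverse (f x) * frechet_derivative f (at x) v * inverse (f x)))) (at x)"
      if "x \<in> U" for x
      using that Suc.prems nz by (intro Deriv.has_derivative_inverse Ck_on_Suc_has_derivative)
    have inv: "Ck_on k (\<lambda>x. inverse (f x)) U"
      by (rule Suc.IH[OF Ck_on_SucD[OF Suc.prems]])
    show "Ck_on k (\<lambda>x. - (inverse (f x) * frechet_derivative f (at x) v * inverse (f x))) U" for v
    proof -
      have "Ck_on k (\<lambda>x. (-1) * (inverse (f x) * frechet_derivative f (at x) v * inverse (f x))) U"
        using Suc.prems inv
        by (intro bounded_bilinear.Ck_on[OF bounded_bilinear_mult] Ck_on_const \<open>open U\<close>) auto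
      then show ?thesis by simp
    qed
  qed
qed

section \<open>Smooth maps and linear systems with smooth coefficients\<close>

lemma smooth_on_cong:
  assumes "open U" "\<And>x. x \<in> U \<Longrightarrow> f x = g x" "smooth_on U f"
  shows "smooth_on U g"
  using assms Ck_on_cong unfolding smooth_on_def by blast

lemma smooth_on_const: "smooth_on U (\<lambda>x. c)"
  by (simp add: smooth_on_def Ck_on_const)

lemma smooth_on_add:
  "open U \<Longrightarrow> smooth_on U f \<Longrightarrow> smooth_on U g \<Longrightarrow> smooth_on U (\<lambda>x. f x + g x)"
  by (simp add: smooth_on_def Ck_on_add)

lemma smooth_on_mult:
  fixes f g :: "'a::euclidean_space \<Rightarrow> real"
  shows "open U \<Longrightarrow> smooth_on U f \<Longrightarrow> smooth_on U g \<Longrightarrow> smooth_on U (\<lambda>x. f x * g x)"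
  by (simp add: smooth_on_def bounded_bilinear.Ck_on[OF bounded_bilinear_mult])

lemma smooth_on_scaleR:
  "open U \<Longrightarrow> smooth_on U f \<Longrightarrow> smooth_on U g \<Longrightarrow> smooth_on U (\<lambda>x. f x *\<^sub>R g x)"
  by (simp add: smooth_on_def bounded_bilinear.Ck_on[OF bounded_bilinear_scaleR])

lemma smooth_on_divide:
  fixes f g :: "'a::euclidean_space \<Rightarrow> real"
  assumes "open U" "smooth_on U f" "smooth_on U g" "\<And>x. x \<in> U \<Longrightarrow> g x \<noteq> 0"
  shows "smooth_on U (\<lambda>x. f x / g x)"
  using assms smooth_on_mult[of U f "\<lambda>x. inverse (g x)"]
  by (simp add: smooth_on_def Ck_on_inverse divide_inverse)

lemma smooth_on_sum:
  assumes "open U" "\<And>i. i \<in> I \<Longrightarrow> smooth_on U (f i)"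
  shows "smooth_on U (\<lambda>x. \<Sum>i\<in>I. f i x)"
  using assms(2)
  by (induction I rule: infinite_finite_induct)
    (auto simp: smooth_on_const intro!: smooth_on_add \<open>open U\<close>)

lemma smooth_on_prod:
  fixes f :: "'i \<Rightarrow> 'a::euclidean_space \<Rightarrow> real"
  assumes "open U" "\<And>i. i \<in> I \<Longrightarrow> smooth_on U (f i)"
  shows "smooth_on U (\<lambda>x. \<Prod>i\<in>I. f i x)"
  using assms(2)
  by (induction I rule: infinite_finite_induct)
    (auto simp: smooth_on_const intro!: smooth_on_mult \<open>open U\<close>)

lemma smooth_on_vec_nth:
  fixes f :: "'a::euclidean_space \<Rightarrow> real ^ 'n"
  assumes "open U" "smooth_on U f"
  shows "smooth_on U (\<lambda>x. f x $ i)"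
  using assms
    bounded_bilinear.Ck_on[OF bounded_bilinear_inner, of U _ "\<lambda>x. axis i 1" f]
  by (simp add: smooth_on_def Ck_on_const inner_axis')

lemma smooth_on_vec_lambda:
  fixes f :: "'n::finite \<Rightarrow> 'a::euclidean_space \<Rightarrow> real"
  assumes "open U" "\<And>i. smooth_on U (f i)"
  shows "smooth_on U (\<lambda>x. \<chi> i. f i x)"
proof (rule smooth_on_cong[OF \<open>open U\<close>])
  show "smooth_on U (\<lambda>x. \<Sum>i\<in>UNIV. f i x *\<^sub>R axis i (1::real))"
    using assms by (intro smooth_on_sum smooth_on_scaleR smooth_on_const)
  show "(\<Sum>i\<in>UNIV. f i x *\<^sub>R axis i (1::real)) = (\<chi> i. f i x)" for x
    using basis_expansion[of "\<chi> i. f i x"] by (simp add: scalar_mult_eq_scaleR)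
qed

lemma smooth_on_det:
  fixes M :: "'a::euclidean_space \<Rightarrow> real ^ 'n ^ 'n"
  assumes "open U" "\<And>i j. smooth_on U (\<lambda>x. M x $ i $ j)"
  shows "smooth_on U (\<lambda>x. det (M x))"
  unfolding det_def using assms
  by (intro smooth_on_sum smooth_on_mult smooth_on_const smooth_on_prod)

text \<open>Cramer's rule writes the coordinates of \<open>y\<close> as quotients of determinants,
  which are polynomials in smooth entries. A solution chosen pointwise, with no regularity known, is
  therefore smooth.\<close>

lemma smooth_on_linear_system:
  fixes M :: "'a::euclidean_space \<Rightarrow> real ^ 'n ^ 'n"
  assumes "open U" and M: "\<And>i j. smooth_on U (\<lambda>x. M x $ i $ j)"
    and b: "\<And>i. smooth_on U (\<lambda>x. b x $ i)"
    and nz: "\<And>x. x \<in> U \<Longrightarrow> det (M x) \<noteq> 0" and sol: "\<And>x. x \<in> U \<Longrightarrow> M x *v y x = b x"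
  shows "smooth_on U y"
proof (rule smooth_on_cong[OF \<open>open U\<close>])
  let ?y = "\<lambda>x. \<chi> k. det (\<chi> i j. if j = k then b x $ i else M x $ i $ j) / det (M x)"
  show "?y x = y x" if "x \<in> U" for x
    using cramer[OF nz[OF that], of "y x" "b x"] sol[OF that] by simp
  have "smooth_on U (\<lambda>x. if j = k then b x $ i else M x $ i $ j)" for i j k
    using M b by (cases "j = k") auto
  then show "smooth_on U ?y"
    using M nz \<open>open U\<close>
    by (intro smooth_on_vec_lambda smooth_on_divide smooth_on_det) auto
qed

lemma smooth_on_has_derivative:
  "smooth_on U f \<Longrightarrow> x \<in> U \<Longrightarrow> (f has_derivative frechet_derivative f (at x)) (at x)"
  unfolding smooth_on_def using Ck_on_Suc_has_derivative by blast

lemma smooth_on_differentiable: "smooth_on U f \<Longrightarrow> x \<in> U \<Longrightarrow> f differentiable (at x)"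
  using smooth_on_has_derivative differentiableI by blast

lemma smooth_on_frechet_derivative:
  "smooth_on U f \<Longrightarrow> smooth_on U (\<lambda>x. frechet_derivative f (at x) v)"
  unfolding smooth_on_def using Ck_on.simps(2) by blast

lemma smooth_on_continuous_on: "smooth_on U f \<Longrightarrow> continuous_on U f"
  unfolding smooth_on_def using Ck_on.simps(1) by blast

section \<open>Symmetry of second derivatives\<close>

lemma frechet_derivative_basis_sum:
  fixes f :: "real ^ 'n \<Rightarrow> 'b::real_normed_vector"
  assumes "f differentiable (at x)"
  shows "frechet_derivative f (at x) v = (\<Sum>i\<in>UNIV. v $ i *\<^sub>R frechet_derivative f (at x) (axis i 1))"
proof -
  have "v = (\<Sum>i\<in>UNIV. v $ i *\<^sub>R axis i 1)"
    using basis_expansion[of v] by (simp add: scalar_mult_eq_scaleR)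
  then have "frechet_derivative f (at x) v
      = frechet_derivative f (at x) (\<Sum>i\<in>UNIV. v $ i *\<^sub>R axis i 1)"
    by simp
  then show ?thesis
    using linear_frechet_derivative[OF assms] by (simp add: linear_sum linear_cmul)
qed

text \<open>Two mean value theorems: one in direction \<open>u\<close> for the difference of
  \<open>F\<close> along \<open>t v\<close>, then one in direction \<open>v\<close> for the
  derivative of \<open>F\<close> along \<open>u\<close>.\<close>

lemma second_difference_mean_value:
  fixes F :: "'a::euclidean_space \<Rightarrow> real"
  assumes F: "smooth_on U F" and "0 < t"
    and U: "\<And>r s. 0 \<le> r \<Longrightarrow> r \<le> t \<Longrightarrow> 0 \<le> s \<Longrightarrow> s \<le> t \<Longrightarrow> a + r *\<^sub>R u + s *\<^sub>R v \<in> U"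
  shows "\<exists>r s. 0 < r \<and> r < t \<and> 0 < s \<and> s < t \<and>
    F (a + t *\<^sub>R u + t *\<^sub>R v) - F (a + t *\<^sub>R u) - F (a + t *\<^sub>R v) + F a
      = t * t * frechet_derivative (\<lambda>x. frechet_derivative F (at x) u)
          (at (a + r *\<^sub>R u + s *\<^sub>R v)) v"
proof -
  define D where "D x = frechet_derivative F (at x)" for x
  define E where "E x = frechet_derivative (\<lambda>x. D x u) (at x)" for x
  have D: "(F has_derivative D x) (at x)" if "x \<in> U" for x
    using smooth_on_has_derivative[OF F that] by (simp add: D_def)
  have E: "((\<lambda>x. D x u) has_derivative E x) (at x)" if "x \<in> U" for x
    using smooth_on_has_derivative[OF smooth_on_frechet_derivative[OF F] that]
    by (simp add: D_def E_def)
  \<comment> \<open>The terms \<open>0 *\<^sub>R u\<close> and \<open>0 *\<^sub>R v\<close> keep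
    each argument in the shape for which \<open>U\<close> gives membership.\<close>
  have "\<exists>r\<in>{0<..<t}. (F (a + t *\<^sub>R u + t *\<^sub>R v) - F (a + t *\<^sub>R u + 0 *\<^sub>R v))
        - (F (a + 0 *\<^sub>R u + t *\<^sub>R v) - F (a + 0 *\<^sub>R u + 0 *\<^sub>R v))
      = (D (a + r *\<^sub>R u + t *\<^sub>R v) ((t - 0) *\<^sub>R u) - D (a + r *\<^sub>R u + 0 *\<^sub>R v) ((t - 0) *\<^sub>R u))"
  proof (rule mvt_simple[OF \<open>0 < t\<close>])
    fix r assume "0 \<le> r" "r \<le> t"
    then show "((\<lambda>r. F (a + r *\<^sub>R u + t *\<^sub>R v) - F (a + r *\<^sub>R u + 0 *\<^sub>R v)) has_derivative
        (\<lambda>h. D (a + r *\<^sub>R u + t *\<^sub>R v) (h *\<^sub>R u) - D (a + r *\<^sub>R u + 0 *\<^sub>R v) (h *\<^sub>R u)))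
        (at r within {0..t})"
      using \<open>0 < t\<close>
      by (intro has_derivative_diff has_derivative_compose[OF _ D] U) (auto intro!: derivative_eq_intros)
  qed
  then obtain r where r: "0 < r" "r < t" and eq1:
    "F (a + t *\<^sub>R u + t *\<^sub>R v) - F (a + t *\<^sub>R u) - F (a + t *\<^sub>R v) + F a
      = D (a + r *\<^sub>R u + t *\<^sub>R v) (t *\<^sub>R u) - D (a + r *\<^sub>R u + 0 *\<^sub>R v) (t *\<^sub>R u)"
    by auto
  have "\<exists>s\<in>{0<..<t}. D (a + r *\<^sub>R u + t *\<^sub>R v) u - D (a + r *\<^sub>R u + 0 *\<^sub>R v) u
      = E (a + r *\<^sub>R u + s *\<^sub>R v) ((t - 0) *\<^sub>R v)"
  proof (rule mvt_simple[OF \<open>0 < t\<close>])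
    fix s assume "0 \<le> s" "s \<le> t"
    then show "((\<lambda>s. D (a + r *\<^sub>R u + s *\<^sub>R v) u) has_derivative
        (\<lambda>h. E (a + r *\<^sub>R u + s *\<^sub>R v) (h *\<^sub>R v))) (at s within {0..t})"
      using r by (intro has_derivative_compose[OF _ E] U) (auto intro!: derivative_eq_intros)
  qed
  then obtain s where s: "0 < s" "s < t" and eq2:
    "D (a + r *\<^sub>R u + t *\<^sub>R v) u - D (a + r *\<^sub>R u + 0 *\<^sub>R v) u = E (a + r *\<^sub>R u + s *\<^sub>R v) (t *\<^sub>R v)"
    by auto
  have lin: "D x (t *\<^sub>R w) = t * D x w" "E x (t *\<^sub>R w) = t * E x w" if "x \<in> U" for x w
    using has_derivative_linear[OF D[OF that]] has_derivative_linear[OF E[OF that]]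
    by (simp_all add: linear_cmul)
  have "a + r *\<^sub>R u + t *\<^sub>R v \<in> U" "a + r *\<^sub>R u + 0 *\<^sub>R v \<in> U" "a + r *\<^sub>R u + s *\<^sub>R v \<in> U"
    using r s \<open>0 < t\<close> by (intro U; simp)+
  note lin = this[THEN lin(1)] this[THEN lin(2)]
  have "F (a + t *\<^sub>R u + t *\<^sub>R v) - F (a + t *\<^sub>R u) - F (a + t *\<^sub>R v) + F a
      = t * (D (a + r *\<^sub>R u + t *\<^sub>R v) u - D (a + r *\<^sub>R u + 0 *\<^sub>R v) u)"
    using eq1 lin by (simp add: algebra_simps)
  also have "\<dots> = t * t * E (a + r *\<^sub>R u + s *\<^sub>R v) v"
    unfolding eq2 lin by simp
  finally show ?thesis
    using r s unfolding E_def D_def by blast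
qed

text \<open>The second difference over a parallelogram is symmetric in \<open>u\<close> and
  \<open>v\<close>, so the two mixed derivatives take a common value at points arbitrarily close to
  \<open>a\<close>. By continuity they cannot differ at \<open>a\<close>.\<close>

lemma symmetric_second_derivative:
  fixes F :: "'a::euclidean_space \<Rightarrow> real"
  assumes "open U" and F: "smooth_on U F" and a: "a \<in> U"
  shows "frechet_derivative (\<lambda>x. frechet_derivative F (at x) u) (at a) v
       = frechet_derivative (\<lambda>x. frechet_derivative F (at x) v) (at a) u"
proof (rule ccontr)
  define E where "E u v x = frechet_derivative (\<lambda>x. frechet_derivative F (at x) u) (at x) v"
    for u v x
  assume "\<not> ?thesis"
  then have pos: "0 < dist (E u v a) (E v u a) / 2" by (simp add: E_def)
  have "isCont (E u v) a" for u v
    using smooth_on_continuous_on[OF smooth_on_frechet_derivative[OF smooth_on_frechet_derivative[OF F]]]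
      a \<open>open U\<close> unfolding E_def by (simp add: continuous_on_eq_continuous_at)
  then have near: "\<forall>\<^sub>F x in nhds a. dist (E u v x) (E u v a) < e" if "0 < e" for u v e
    using that tendstoD[of "E u v" "E u v a" "nhds a" e] isCont_def tendsto_at_iff_tendsto_nhds
    by blast
  have "\<forall>\<^sub>F x in nhds a. x \<in> U \<and> dist (E u v x) (E u v a) < dist (E u v a) (E v u a) / 2 \<and>
      dist (E v u x) (E v u a) < dist (E u v a) (E v u a) / 2"
    using near[OF pos] eventually_nhds_in_open[OF \<open>open U\<close> a] by (simp add: eventually_conj)
  then obtain d where "0 < d" and d: "\<And>x. dist x a < d \<Longrightarrow> x \<in> U \<and>
      dist (E u v x) (E u v a) < dist (E u v a) (E v u a) / 2 \<and>
      dist (E v u x) (E v u a) < dist (E u v a) (E v u a) / 2"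
    unfolding eventually_nhds_metric by blast
  \<comment> \<open>Small enough that the whole parallelogram stays within distance \<open>d\<close>
    of \<open>a\<close>; the summand 1 keeps the denominator positive when \<open>u\<close> and
    \<open>v\<close> vanish.\<close>
  define t where "t = d / (2 * (norm u + norm v + 1))"
  have n1: "0 < norm u + norm v + 1" by (simp add: add_nonneg_pos)
  then have "0 < t" using \<open>0 < d\<close> by (simp add: t_def)
  have close: "dist (a + r *\<^sub>R u + s *\<^sub>R v) a < d" if "0 \<le> r" "r \<le> t" "0 \<le> s" "s \<le> t" for r s
  proof -
    have "dist (a + r *\<^sub>R u + s *\<^sub>R v) a = norm (r *\<^sub>R u + s *\<^sub>R v)"
      by (simp add: dist_norm add.assoc)
    also have "\<dots> \<le> r * norm u + s * norm v"
      using norm_triangle_ineq[of "r *\<^sub>R u" "s *\<^sub>R v"] that by simp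
    also have "\<dots> \<le> t * norm u + t * norm v"
      using that by (intro add_mono mult_right_mono) auto
    also have "\<dots> < t * (norm u + norm v + 1)"
      using \<open>0 < t\<close> by (simp add: algebra_simps)
    also have "\<dots> = d / 2" using n1 by (simp add: t_def field_simps)
    finally show ?thesis using \<open>0 < d\<close> by simp
  qed
  then have close': "dist (a + r *\<^sub>R v + s *\<^sub>R u) a < d"
    if "0 \<le> r" "r \<le> t" "0 \<le> s" "s \<le> t" for r s
    using that by (metis add.commute add.left_commute)
  obtain r s where 1: "0 < r" "r < t" "0 < s" "s < t" and
    "F (a + t *\<^sub>R u + t *\<^sub>R v) - F (a + t *\<^sub>R u) - F (a + t *\<^sub>R v) + F a
      = t * t * E u v (a + r *\<^sub>R u + s *\<^sub>R v)"
    using second_difference_mean_value[OF F \<open>0 < t\<close>, of a u v] close d unfolding E_def by metis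
  moreover obtain r' s' where 2: "0 < r'" "r' < t" "0 < s'" "s' < t" and
    "F (a + t *\<^sub>R v + t *\<^sub>R u) - F (a + t *\<^sub>R v) - F (a + t *\<^sub>R u) + F a
      = t * t * E v u (a + r' *\<^sub>R v + s' *\<^sub>R u)"
    using second_difference_mean_value[OF F \<open>0 < t\<close>, of a v u] close' d unfolding E_def by metis
  moreover have "F (a + t *\<^sub>R v + t *\<^sub>R u) = F (a + t *\<^sub>R u + t *\<^sub>R v)"
    by (simp add: ac_simps)
  ultimately have "t * t * E u v (a + r *\<^sub>R u + s *\<^sub>R v) = t * t * E v u (a + r' *\<^sub>R v + s' *\<^sub>R u)"
    by linarith
  then have "E u v (a + r *\<^sub>R u + s *\<^sub>R v) = E v u (a + r' *\<^sub>R v + s' *\<^sub>R u)"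
    using \<open>0 < t\<close> by simp
  \<comment> \<open>The common value lies within half of the distance between \<open>E u v a\<close>
    and \<open>E v u a\<close> from each of them, against the triangle inequality.\<close>
  with d[OF close[of r s]] d[OF close'[of r' s']] 1 2
  show False
    using dist_triangle_half_r[of "E u v (a + r *\<^sub>R u + s *\<^sub>R v)" "E u v a"
        "dist (E u v a) (E v u a)" "E v u a"] by (simp add: dist_commute)
qed

section \<open>Tangent vectors and vector fields\<close>

locale smooth_atlas =
  fixes A :: "('m::{t2_space, second_countable_topology}, 'n::finite) chart set"
  assumes manifold: "smooth_manifold A"
begin

section \<open>Charts and coordinate changes\<close>

lemma chart_at_in: "chart_at A p \<in> charts_at A p"
proof -
  have "\<exists>c. c \<in> charts_at A p"
    using manifold unfolding smooth_manifold_def charts_at_def by blast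
  then show ?thesis unfolding chart_at_def by (rule someI_ex)
qed

lemma charts_atD: "c \<in> charts_at A p \<Longrightarrow> c \<in> A" "c \<in> charts_at A p \<Longrightarrow> p \<in> dom_of c"
  by (auto simp: charts_at_def)

lemma chart_homeomorphism:
  "c \<in> A \<Longrightarrow> homeomorphism (dom_of c) (range_of c) (coord c) (param c)"
  using manifold unfolding smooth_manifold_def by blast

lemma open_range_of: "c \<in> A \<Longrightarrow> open (range_of c)"
  using manifold unfolding smooth_manifold_def by blast

lemma open_dom_of: "c \<in> A \<Longrightarrow> open (dom_of c)"
  using manifold unfolding smooth_manifold_def by blast

lemma param_coord: "c \<in> A \<Longrightarrow> p \<in> dom_of c \<Longrightarrow> param c (coord c p) = p"
  using chart_homeomorphism homeomorphism_apply1 by blast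

lemma coord_param: "c \<in> A \<Longrightarrow> x \<in> range_of c \<Longrightarrow> coord c (param c x) = x"
  using chart_homeomorphism homeomorphism_apply2 by blast

lemma coord_in_range: "p \<in> dom_of c \<Longrightarrow> coord c p \<in> range_of c"
  by (simp add: range_of_def)

lemma param_in_dom: "c \<in> A \<Longrightarrow> x \<in> range_of c \<Longrightarrow> param c x \<in> dom_of c"
  using chart_homeomorphism homeomorphism_image2 by blast

lemma charts_at_param: "c \<in> A \<Longrightarrow> x \<in> range_of c \<Longrightarrow> c \<in> charts_at A (param c x)"
  using param_in_dom by (auto simp: charts_at_def)

lemma open_coord_image: "c \<in> A \<Longrightarrow> d \<in> A \<Longrightarrow> open (coord c ` (dom_of c \<inter> dom_of d))"
  by (metis chart_homeomorphism homeomorphism_imp_open_map inf_le1 open_Int open_dom_of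
      open_openin_trans open_range_of openin_open_trans)

lemma transition_has_derivative:
  assumes "c \<in> charts_at A p" "d \<in> charts_at A p"
  shows "((coord d \<circ> param c) has_derivative
    frechet_derivative (coord d \<circ> param c) (at (coord c p))) (at (coord c p))"
proof (rule smooth_on_has_derivative)
  show "smooth_on (coord c ` (dom_of c \<inter> dom_of d)) (coord d \<circ> param c)"
    using assms manifold unfolding smooth_manifold_def charts_at_def by blast
  show "coord c p \<in> coord c ` (dom_of c \<inter> dom_of d)"
    using assms by (auto simp: charts_at_def)
qed

text \<open>Chain rule through the coordinate change; the factorisation holds only on the chart
  overlap, which is open around the point. For real \<open>h\<close> it makes differentials
  independent of the chart, and for \<open>h = coord e\<close> it is the cocycle rule for
  Jacobians.\<close>

lemma chart_change_derivative:
  assumes c: "c \<in> charts_at A p" and d: "d \<in> charts_at A p"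
    and h: "(h \<circ> param d) differentiable (at (coord d p))"
  shows "frechet_derivative (h \<circ> param c) (at (coord c p)) w =
    frechet_derivative (h \<circ> param d) (at (coord d p))
      (frechet_derivative (coord d \<circ> param c) (at (coord c p)) w)"
proof -
  have "(coord d \<circ> param c) (coord c p) = coord d p"
    using charts_atD[OF c] param_coord by simp
  then have "((h \<circ> param d \<circ> (coord d \<circ> param c)) has_derivative
      frechet_derivative (h \<circ> param d) (at (coord d p)) \<circ>
      frechet_derivative (coord d \<circ> param c) (at (coord c p))) (at (coord c p))"
    using transition_has_derivative[OF c d] h
    by (intro diff_chain_at) (auto simp: frechet_derivative_works)
  then have "((h \<circ> param c) has_derivative
      frechet_derivative (h \<circ> param d) (at (coord d p)) \<circ>
      frechet_derivative (coord d \<circ> param c) (at (coord c p))) (at (coord c p))"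
  proof (rule has_derivative_transform_within_open)
    show "open (coord c ` (dom_of c \<inter> dom_of d))"
      using charts_atD c d open_coord_image by blast
    show "coord c p \<in> coord c ` (dom_of c \<inter> dom_of d)"
      using charts_atD c d by blast
    show "(h \<circ> param d \<circ> (coord d \<circ> param c)) x = (h \<circ> param c) x"
      if "x \<in> coord c ` (dom_of c \<inter> dom_of d)" for x
      using that param_coord[OF charts_atD(1)[OF c]] param_coord[OF charts_atD(1)[OF d]] by force
  qed
  then show ?thesis using frechet_derivative_at by (metis comp_apply)
qed

lemma chart_identity_derivative:
  assumes "c \<in> charts_at A p"
  shows "frechet_derivative (coord c \<circ> param c) (at (coord c p)) = id"
proof -
  have "(id has_derivative id) (at (coord c p))" by (simp add: id_def)
  then have "((coord c \<circ> param c) has_derivative id) (at (coord c p))"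
    by (rule has_derivative_transform_within_open[OF _ open_range_of[of c]])
      (use charts_atD[OF assms] in \<open>simp_all add: coord_in_range coord_param\<close>)
  then show ?thesis by (simp add: frechet_derivative_at[symmetric])
qed

section \<open>Tangent spaces in coordinates\<close>

lemma tangent_change:
  "v \<in> tangent_space A p \<Longrightarrow> c \<in> charts_at A p \<Longrightarrow> d \<in> charts_at A p \<Longrightarrow>
    v d = frechet_derivative (coord d \<circ> param c) (at (coord c p)) (v c)"
  unfolding tangent_space_def by blast

lemma tangent_outside: "v \<in> tangent_space A p \<Longrightarrow> c \<notin> charts_at A p \<Longrightarrow> v c = 0"
  unfolding tangent_space_def by blast

lemma tangent_spaceI:
  assumes "\<And>c d. c \<in> charts_at A p \<Longrightarrow> d \<in> charts_at A p \<Longrightarrow>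
      frechet_derivative (coord d \<circ> param c) (at (coord c p)) (v c) = v d"
    and "\<And>c. c \<notin> charts_at A p \<Longrightarrow> v c = 0"
  shows "v \<in> tangent_space A p"
  unfolding tangent_space_def using assms by (intro CollectI conjI ballI allI impI) (simp only:)+

text \<open>The required compatibility between any two charts is the cocycle rule for
  Jacobians.\<close>

lemma tvec_of_in_tangent_space:
  assumes "c \<in> charts_at A p"
  shows "tvec_of A c p w \<in> tangent_space A p"
proof (rule tangent_spaceI)
  fix d e assume de: "d \<in> charts_at A p" "e \<in> charts_at A p"
  show "frechet_derivative (coord e \<circ> param d) (at (coord d p)) (tvec_of A c p w d)
      = tvec_of A c p w e"
    using chart_change_derivative[OF assms de(1) differentiableI[OF transition_has_derivative[OF de]], of w]
      de by (simp add: tvec_of_def)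
qed (simp add: tvec_of_def)

text \<open>With \<open>tvec_of_components\<close>, this identifies the tangent space with the
  coordinate space of one chart, so vectors can be compared and constructed there.\<close>

lemma tvec_of_self: "c \<in> charts_at A p \<Longrightarrow> tvec_of A c p w c = w"
  by (simp add: tvec_of_def chart_identity_derivative)

lemma tvec_of_components:
  "v \<in> tangent_space A p \<Longrightarrow> c \<in> charts_at A p \<Longrightarrow> tvec_of A c p (v c) = v"
  by (rule ext) (simp add: tvec_of_def tangent_change[symmetric] tangent_outside)

lemma tangent_eqI:
  "u \<in> tangent_space A p \<Longrightarrow> v \<in> tangent_space A p \<Longrightarrow> c \<in> charts_at A p \<Longrightarrow> u c = v c \<Longrightarrow> u = v"
  by (metis tvec_of_components)

text \<open>The transformation law is preserved because the Jacobians are linear.\<close>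

lemma tangent_space_closed:
  assumes "u \<in> tangent_space A p" "v \<in> tangent_space A p"
  shows "u + v \<in> tangent_space A p" "(\<lambda>c. a *\<^sub>R u c) \<in> tangent_space A p"
    "(0 :: ('m, 'n) tvec) \<in> tangent_space A p"
proof -
  have "linear (frechet_derivative (coord d \<circ> param c) (at (coord c p)))"
    if "c \<in> charts_at A p" "d \<in> charts_at A p" for c d
    using has_derivative_linear transition_has_derivative that by blast
  note lin = linear_add[OF this] linear_cmul[OF this] linear_0[OF this]
  show "u + v \<in> tangent_space A p" "(\<lambda>c. a *\<^sub>R u c) \<in> tangent_space A p"
    "(0 :: ('m, 'n) tvec) \<in> tangent_space A p"
    using assms
    by (intro tangent_spaceI; simp add: lin tangent_change[symmetric] tangent_outside)+
qed

lemma tvec_of_linear: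
  assumes "c \<in> charts_at A p"
  shows "tvec_of A c p (v + w) = tvec_of A c p v + tvec_of A c p w"
    "tvec_of A c p (a *\<^sub>R v) = (\<lambda>d. a *\<^sub>R tvec_of A c p v d)"
proof -
  show "tvec_of A c p (v + w) = tvec_of A c p v + tvec_of A c p w"
    by (rule tangent_eqI[OF _ _ assms])
      (use assms in \<open>auto simp: tvec_of_self intro: tangent_space_closed tvec_of_in_tangent_space\<close>)
  show "tvec_of A c p (a *\<^sub>R v) = (\<lambda>d. a *\<^sub>R tvec_of A c p v d)"
    by (rule tangent_eqI[OF _ _ assms])
      (use assms in \<open>auto simp: tvec_of_self intro: tangent_space_closed tvec_of_in_tangent_space\<close>)
qed

section \<open>Vector fields, differentials and the bracket\<close>

lemma vector_field_tangent: "X \<in> vector_fields A \<Longrightarrow> X p \<in> tangent_space A p"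
  by (simp add: vector_fields_def)

lemma vector_field_smooth: "X \<in> vector_fields A \<Longrightarrow> c \<in> A \<Longrightarrow> smooth_on (range_of c) (comp_in c X)"
  by (simp add: vector_fields_def)

lemma comp_in_coord: "c \<in> charts_at A p \<Longrightarrow> comp_in c X (coord c p) = X p c"
  by (simp add: comp_in_def param_coord charts_atD)

lemma vector_fields_add:
  assumes "X \<in> vector_fields A" "Y \<in> vector_fields A"
  shows "X + Y \<in> vector_fields A"
proof -
  have "comp_in c (X + Y) = (\<lambda>x. comp_in c X x + comp_in c Y x)" for c
    by (simp add: comp_in_def fun_eq_iff)
  with assms show ?thesis
    by (auto simp: vector_fields_def open_range_of intro!: tangent_space_closed smooth_on_add)
qed

lemma vector_fields_vscale:
  assumes "smooth_fun A h" "X \<in> vector_fields A"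
  shows "h \<odot> X \<in> vector_fields A"
proof -
  have eq: "comp_in c (h \<odot> X) = (\<lambda>x. (h \<circ> param c) x *\<^sub>R comp_in c X x)" for c
    by (simp add: comp_in_def vscale_def fun_eq_iff)
  have "smooth_on (range_of c) (comp_in c (h \<odot> X))" if "c \<in> A" for c
    unfolding eq using assms that
    by (intro smooth_on_scaleR open_range_of) (unfold smooth_fun_def vector_fields_def, blast+)
  moreover have "(h \<odot> X) p \<in> tangent_space A p" for p
    unfolding vscale_def
    by (rule tangent_space_closed(2)) (rule vector_field_tangent[OF assms(2)])+
  ultimately show ?thesis by (simp add: vector_fields_def)
qed

lemma smooth_fun_const: "smooth_fun A (\<lambda>_. a)"
  by (simp add: smooth_fun_def smooth_on_const comp_def)

lemma smooth_fun_cmult: "smooth_fun A h \<Longrightarrow> smooth_fun A (\<lambda>p. a * h p)"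
  unfolding smooth_fun_def comp_def
  by (auto intro!: smooth_on_mult smooth_on_const open_range_of)

lemma smooth_fun_differentiable:
  assumes "smooth_fun A h" "c \<in> charts_at A p"
  shows "(h \<circ> param c) differentiable (at (coord c p))"
proof (rule smooth_on_differentiable)
  show "smooth_on (range_of c) (h \<circ> param c)"
    using assms(1) charts_atD(1)[OF assms(2)] unfolding smooth_fun_def by blast
qed (rule coord_in_range[OF charts_atD(2)[OF assms(2)]])

text \<open>The transformation law of \<open>v\<close> compensates that of the derivative, so the
  arbitrary \<open>chart_at A p\<close> can be exchanged for any convenient chart.\<close>

lemma differential_eq:
  assumes "smooth_fun A h" "c \<in> charts_at A p" "v \<in> tangent_space A p"
  shows "differential A h p v = frechet_derivative (h \<circ> param c) (at (coord c p)) (v c)"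
  unfolding differential_def Let_def
  using assms chart_change_derivative[OF chart_at_in assms(2) smooth_fun_differentiable[OF assms(1,2)]]
    tangent_change[OF assms(3) chart_at_in assms(2)]
  by simp

lemma linear_differential:
  assumes "smooth_fun A h"
  shows "differential A h p (u + v) = differential A h p u + differential A h p v"
    "differential A h p (u - v) = differential A h p u - differential A h p v"
    "differential A h p (\<lambda>c. a *\<^sub>R u c) = a * differential A h p u"
proof -
  have "linear (frechet_derivative (h \<circ> param (chart_at A p)) (at (coord (chart_at A p) p)))"
    by (intro linear_frechet_derivative smooth_fun_differentiable assms chart_at_in)
  then show "differential A h p (u + v) = differential A h p u + differential A h p v"
    "differential A h p (u - v) = differential A h p u - differential A h p v"
    "differential A h p (\<lambda>c. a *\<^sub>R u c) = a * differential A h p u"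
    unfolding differential_def Let_def by (simp_all add: linear_add linear_diff linear_cmul)
qed

lemma one_form_differential:
  assumes "smooth_fun A h"
  shows "one_form A (differential A h)"
proof -
  have "smooth_on (range_of c) (\<lambda>x. differential A h (param c x) (tvec_of A c (param c x) w))"
    if c: "c \<in> A" for c w
  proof (rule smooth_on_cong[OF open_range_of[OF c]])
    show "smooth_on (range_of c) (\<lambda>x. frechet_derivative (h \<circ> param c) (at x) w)"
      using assms c by (auto simp: smooth_fun_def intro: smooth_on_frechet_derivative)
    show "frechet_derivative (h \<circ> param c) (at x) w
        = differential A h (param c x) (tvec_of A c (param c x) w)" if "x \<in> range_of c" for x
      using that c assms charts_at_param coord_param
      by (subst differential_eq[where c = c]) (auto simp: tvec_of_in_tangent_space tvec_of_self)
  qed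
  then show ?thesis
    unfolding one_form_def by (simp add: linear_differential assms)
qed

text \<open>The coordinate formula for \<open>X h\<close>. Expanding in fixed basis directions
  separates the components of \<open>X\<close> from partial derivatives, to which the smoothness
  rules apply.\<close>

lemma deriv_along_coord:
  assumes "smooth_fun A h" "X \<in> vector_fields A" "c \<in> A" "x \<in> range_of c"
  shows "deriv_along A X h (param c x) =
    (\<Sum>i\<in>UNIV. comp_in c X x $ i * frechet_derivative (h \<circ> param c) (at x) (axis i 1))"
proof -
  have c: "c \<in> charts_at A (param c x)" using charts_at_param assms by blast
  have "(h \<circ> param c) differentiable (at x)"
    using smooth_fun_differentiable[OF assms(1) c] coord_param assms by simp
  then show ?thesis
    unfolding deriv_along_def
    using differential_eq[OF assms(1) c vector_field_tangent[OF assms(2)]]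
      coord_param[OF assms(3,4)] frechet_derivative_basis_sum[of "h \<circ> param c" x "X (param c x) c"]
    by (simp add: comp_in_def)
qed

lemma smooth_fun_deriv_along:
  assumes "smooth_fun A h" "X \<in> vector_fields A"
  shows "smooth_fun A (deriv_along A X h)"
  unfolding smooth_fun_def
proof
  fix c assume c: "c \<in> A"
  show "smooth_on (range_of c) (deriv_along A X h \<circ> param c)"
  proof (rule smooth_on_cong[OF open_range_of[OF c]])
    show "smooth_on (range_of c)
      (\<lambda>x. \<Sum>i\<in>UNIV. comp_in c X x $ i * frechet_derivative (h \<circ> param c) (at x) (axis i 1))"
      using assms c by (intro smooth_on_sum smooth_on_mult smooth_on_vec_nth open_range_of
        smooth_on_frechet_derivative vector_field_smooth) (auto simp: smooth_fun_def)
  qed (simp add: deriv_along_coord assms c)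
qed

text \<open>Leibniz rule for the coordinate formula of \<open>Y h\<close>: one term differentiates
  the components of \<open>Y\<close>, the other holds the second derivatives of \<open>h\<close>,
  which cancel in the commutator.\<close>

lemma deriv_along_twice:
  assumes h: "smooth_fun A h" and X: "X \<in> vector_fields A" and Y: "Y \<in> vector_fields A"
    and c: "c \<in> charts_at A p"
  shows "deriv_along A X (deriv_along A Y h) p =
    frechet_derivative (h \<circ> param c) (at (coord c p))
      (frechet_derivative (comp_in c Y) (at (coord c p)) (X p c)) +
    (\<Sum>i\<in>UNIV. \<Sum>j\<in>UNIV. Y p c $ i * X p c $ j *
      frechet_derivative (\<lambda>x. frechet_derivative (h \<circ> param c) (at x) (axis i 1))
        (at (coord c p)) (axis j 1))"
proof -
  define F where "F = h \<circ> param c"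
  define x0 where "x0 = coord c p"
  define v where "v = X p c"
  define D where "D i x = frechet_derivative F (at x) (axis i 1)" for i x
  have cA: "c \<in> A" and x0: "x0 \<in> range_of c"
    using charts_atD[OF c] by (simp_all add: x0_def coord_in_range)
  have F: "smooth_on (range_of c) F" using h cA by (auto simp: F_def smooth_fun_def)
  have D: "smooth_on (range_of c) (D i)" for i
    unfolding D_def by (rule smooth_on_frechet_derivative[OF F])
  have Ys: "smooth_on (range_of c) (comp_in c Y)" by (rule vector_field_smooth[OF Y cA])
  have Yd: "(comp_in c Y has_derivative frechet_derivative (comp_in c Y) (at x0)) (at x0)"
    by (rule smooth_on_has_derivative[OF Ys x0])
  have "((\<lambda>x. comp_in c Y x $ i) has_derivative
      (\<lambda>w. frechet_derivative (comp_in c Y) (at x0) w $ i)) (at x0)" for i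
    by (rule bounded_linear.has_derivative[OF bounded_linear_vec_nth Yd])
  then have "((\<lambda>x. \<Sum>i\<in>UNIV. comp_in c Y x $ i * D i x) has_derivative
      (\<lambda>w. \<Sum>i\<in>UNIV. comp_in c Y x0 $ i * frechet_derivative (D i) (at x0) w +
        frechet_derivative (comp_in c Y) (at x0) w $ i * D i x0)) (at x0)"
    by (intro has_derivative_sum has_derivative_mult smooth_on_has_derivative[OF D x0])
  then have "((deriv_along A Y h \<circ> param c) has_derivative
      (\<lambda>w. \<Sum>i\<in>UNIV. comp_in c Y x0 $ i * frechet_derivative (D i) (at x0) w +
        frechet_derivative (comp_in c Y) (at x0) w $ i * D i x0)) (at x0)"
    by (rule has_derivative_transform_within_open[OF _ open_range_of[OF cA] x0])
      (simp add: deriv_along_coord[OF h Y cA] D_def F_def)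
  then have "deriv_along A X (deriv_along A Y h) p =
      (\<Sum>i\<in>UNIV. Y p c $ i * frechet_derivative (D i) (at x0) v +
        frechet_derivative (comp_in c Y) (at x0) v $ i * D i x0)"
    unfolding deriv_along_def[of A X]
      differential_eq[OF smooth_fun_deriv_along[OF h Y] c vector_field_tangent[OF X]]
    by (simp add: frechet_derivative_at[symmetric] x0_def v_def comp_in_coord[OF c])
  also have "\<dots> = (\<Sum>i\<in>UNIV. Y p c $ i * frechet_derivative (D i) (at x0) v) +
      frechet_derivative F (at x0) (frechet_derivative (comp_in c Y) (at x0) v)"
    using frechet_derivative_basis_sum[OF smooth_on_differentiable[OF F x0],
        of "frechet_derivative (comp_in c Y) (at x0) v"]
    by (simp add: sum.distrib D_def)
  also have "(\<Sum>i\<in>UNIV. Y p c $ i * frechet_derivative (D i) (at x0) v) =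
      (\<Sum>i\<in>UNIV. \<Sum>j\<in>UNIV. Y p c $ i * v $ j * frechet_derivative (D i) (at x0) (axis j 1))"
    by (subst frechet_derivative_basis_sum[OF smooth_on_differentiable[OF D x0]])
      (simp add: sum_distrib_left mult.assoc)
  finally show ?thesis by (simp only: D_def[abs_def] F_def x0_def v_def add.commute)
qed

text \<open>Symmetry of second derivatives removes the second-order terms of the commutator; what
  remains is the differential of \<open>h\<close> on the coordinate expression of the
  bracket.\<close>

lemma deriv_along_bracket:
  assumes h: "smooth_fun A h" and X: "X \<in> vector_fields A" and Y: "Y \<in> vector_fields A"
  shows "deriv_along A (bracket A X Y) h p =
    deriv_along A X (deriv_along A Y h) p - deriv_along A Y (deriv_along A X h) p"
proof -
  define c where "c = chart_at A p"
  define H where "H i j = frechet_derivative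
    (\<lambda>x. frechet_derivative (h \<circ> param c) (at x) (axis i (1::real))) (at (coord c p)) (axis j 1)"
    for i j
  have c: "c \<in> charts_at A p" by (simp add: c_def chart_at_in)
  then have "c \<in> A" "coord c p \<in> range_of c" using charts_atD[OF c] by (simp_all add: coord_in_range)
  then have "H i j = H j i" for i j
    unfolding H_def using h
    by (intro symmetric_second_derivative[OF open_range_of]) (auto simp: smooth_fun_def)
  then have "(\<Sum>i\<in>UNIV. \<Sum>j\<in>UNIV. Y p c $ i * X p c $ j * H i j) =
      (\<Sum>i\<in>UNIV. \<Sum>j\<in>UNIV. X p c $ i * Y p c $ j * H i j)"
    by (subst sum.swap) (simp add: mult_ac)
  moreover have "linear (frechet_derivative (h \<circ> param c) (at (coord c p)))"
    by (intro linear_frechet_derivative smooth_fun_differentiable h c)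
  ultimately show ?thesis
    unfolding deriv_along_twice[OF h X Y c] deriv_along_twice[OF h Y X c] H_def[symmetric]
    using c by (simp add: deriv_along_def differential_def c_def[symmetric] bracket_def linear_diff)
qed

end

section \<open>Musical isomorphisms\<close>

locale riemannian = smooth_atlas A
  for A :: "('m::{t2_space, second_countable_topology}, 'n::finite) chart set" +
  fixes g :: "('m, 'n) metric"
  assumes metric: "riemannian_metric A g"
begin

section \<open>The metric at a point and its Gram matrix\<close>

lemma
  assumes "u \<in> tangent_space A p" "v \<in> tangent_space A p"
  shows metric_sym: "g p u v = g p v u"
    and metric_scale: "g p (\<lambda>c. a *\<^sub>R u c) v = a * g p u v"
    and metric_pos: "u \<noteq> 0 \<Longrightarrow> 0 < g p u u"
  using metric assms unfolding riemannian_metric_def by blast+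

lemma metric_add:
  "u \<in> tangent_space A p \<Longrightarrow> v \<in> tangent_space A p \<Longrightarrow> w \<in> tangent_space A p \<Longrightarrow>
    g p (u + v) w = g p u w + g p v w"
  using metric unfolding riemannian_metric_def by blast

lemma metric_zero: "v \<in> tangent_space A p \<Longrightarrow> g p 0 v = 0"
  using metric_scale[of 0 p v 0] tangent_space_closed(3) by (simp add: zero_fun_def)

lemma metric_nondegenerate:
  assumes u: "u \<in> tangent_space A p" and v: "v \<in> tangent_space A p"
    and eq: "\<And>w. w \<in> tangent_space A p \<Longrightarrow> g p u w = g p v w"
  shows "u = v"
proof -
  \<comment> \<open>This is \<open>u - v\<close>, written with a sum and a scalar multiple to match
    the axioms of \<open>riemannian_metric\<close>. It is paired with itself below.\<close>
  define w where "w = u + (\<lambda>c. (-1) *\<^sub>R v c)"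
  have T: "(\<lambda>c. (-1) *\<^sub>R v c) \<in> tangent_space A p" "w \<in> tangent_space A p"
    unfolding w_def by (intro tangent_space_closed(1)[OF u u] tangent_space_closed(1)[OF u]
        tangent_space_closed(2)[OF v v])+
  have "g p w w = g p u w + (-1) * g p v w"
    unfolding w_def
    by (metis T metric_add metric_scale u v w_def)
  then have "g p w w = 0" using eq[OF T(2)] by simp
  then have "w = 0" using metric_pos[OF T(2) T(2)] by force
  then show ?thesis by (simp add: w_def fun_eq_iff)
qed

definition gram :: "('m, 'n) chart \<Rightarrow> 'm \<Rightarrow> real ^ 'n ^ 'n" where
  "gram c p = (\<chi> i j. g p (tvec_of A c p (axis i 1)) (tvec_of A c p (axis j 1)))"

lemma linear_metric_tvec_of:
  assumes c: "c \<in> charts_at A p" and u: "u \<in> tangent_space A p"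
  shows "linear (\<lambda>y. g p u (tvec_of A c p y))"
proof -
  note T = tvec_of_in_tangent_space[OF c]
  have "linear (\<lambda>y. g p (tvec_of A c p y) u)"
    by (rule linearI) (simp_all add: tvec_of_linear[OF c] metric_add metric_scale T u)
  then show ?thesis by (simp add: metric_sym[OF u T])
qed

text \<open>Turns duality into linear algebra: prescribing the pairings with the coordinate basis
  amounts to a linear system for the components.\<close>

lemma gram_mult:
  assumes c: "c \<in> charts_at A p"
  shows "(gram c p *v x) $ i = g p (tvec_of A c p x) (tvec_of A c p (axis i 1))"
proof -
  note T = tvec_of_in_tangent_space[OF c]
  define L where "L y = g p (tvec_of A c p (axis i 1)) (tvec_of A c p y)" for y
  have "linear L" unfolding L_def by (rule linear_metric_tvec_of[OF c T])
  then have "L (\<Sum>j\<in>UNIV. x $ j *\<^sub>R axis j 1) = (\<Sum>j\<in>UNIV. x $ j * L (axis j 1))"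
    by (simp add: linear_sum linear_cmul)
  also have "(\<Sum>j\<in>UNIV. x $ j *\<^sub>R axis j 1) = x"
    using basis_expansion[of x] by (simp add: scalar_mult_eq_scaleR)
  finally show ?thesis
    by (simp add: L_def metric_sym[OF T T, of x] gram_def matrix_vector_mult_def mult.commute)
qed

text \<open>Tangent spaces are sets rather than types, so linearity is expressed after composing
  with the isomorphism \<open>tvec_of A c p\<close>.\<close>

lemma linear_functional_eqI:
  fixes \<phi> \<psi> :: "('m, 'n) tvec \<Rightarrow> real"
  assumes c: "c \<in> charts_at A p" and v: "v \<in> tangent_space A p"
    and "linear (\<lambda>x. \<phi> (tvec_of A c p x))" "linear (\<lambda>x. \<psi> (tvec_of A c p x))"
    and "\<And>i. \<phi> (tvec_of A c p (axis i 1)) = \<psi> (tvec_of A c p (axis i 1))"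
  shows "\<phi> v = \<psi> v"
proof -
  have "(\<lambda>x. \<phi> (tvec_of A c p x)) = (\<lambda>x. \<psi> (tvec_of A c p x))"
    by (rule linear_eq_stdbasis[OF assms(3,4)]) (use assms(5) in \<open>auto simp: Basis_vec_def\<close>)
  from fun_cong[OF this, of "v c"] show ?thesis by (simp add: tvec_of_components[OF v c])
qed

text \<open>A kernel vector is orthogonal to the coordinate basis, hence to itself, and vanishes by
  positive definiteness.\<close>

lemma det_gram:
  assumes c: "c \<in> charts_at A p"
  shows "det (gram c p) \<noteq> 0"
proof -
  note T = tvec_of_in_tangent_space[OF c]
  have "x = 0" if "gram c p *v x = 0" for x
  proof -
    have 0: "g p (tvec_of A c p x) (tvec_of A c p (axis i 1)) = 0" for i
      using gram_mult[OF c, of x i] that by simp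
    have "g p (tvec_of A c p x) (tvec_of A c p x) = 0"
      using linear_metric_tvec_of[OF c T] linear_functional_eqI[OF c T, of "g p (tvec_of A c p x)" "\<lambda>_. 0"] 0
      by (simp add: linear_zero)
    then have "tvec_of A c p x = 0" using metric_pos[OF T T] by force
    then show ?thesis using tvec_of_self[OF c, of x] by simp
  qed
  then show ?thesis
    using matrix_left_invertible_ker invertible_left_inverse invertible_det_nz by blast
qed

section \<open>The metric dual of a 1-form\<close>

lemma sharp_unique:
  assumes "G \<in> vector_fields A" "\<And>p v. v \<in> tangent_space A p \<Longrightarrow> g p (G p) v = \<gamma> p v"
    and "H \<in> vector_fields A" "\<And>p v. v \<in> tangent_space A p \<Longrightarrow> g p (H p) v = \<gamma> p v"
  shows "G = H"
proof
  fix p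
  show "G p = H p"
    by (rule metric_nondegenerate[where p = p]) (simp_all add: assms vector_field_tangent)
qed

text \<open>At each point the Gram system is solved in an arbitrarily chosen chart. Duality is a
  chart-free statement, so the choice does not spoil smoothness.\<close>

lemma sharp_exists:
  assumes \<gamma>: "one_form A \<gamma>"
  shows "\<exists>G\<in>vector_fields A. \<forall>p. \<forall>v\<in>tangent_space A p. g p (G p) v = \<gamma> p v"
proof -
  define b where "b c p = (\<chi> i. \<gamma> p (tvec_of A c p (axis i 1)))" for c p
  define G where "G p = (let c = chart_at A p in
    tvec_of A c p (SOME x. gram c p *v x = b c p))" for p
  have GT: "G p \<in> tangent_space A p" for p
    unfolding G_def Let_def by (intro tvec_of_in_tangent_space chart_at_in)
  have dual: "g p (G p) v = \<gamma> p v" if v: "v \<in> tangent_space A p" for p v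
  proof -
    define c where "c = chart_at A p"
    have c: "c \<in> charts_at A p" by (simp add: c_def chart_at_in)
    note T = tvec_of_in_tangent_space[OF c]
    define x where "x = (SOME x. gram c p *v x = b c p)"
    have Gx: "G p = tvec_of A c p x" by (simp add: G_def x_def c_def Let_def)
    have "\<exists>x. gram c p *v x = b c p" using cramer[OF det_gram[OF c]] by blast
    then have x: "gram c p *v x = b c p" unfolding x_def by (rule someI_ex)
    have "g p (G p) (tvec_of A c p (axis i 1)) = \<gamma> p (tvec_of A c p (axis i 1))" for i
      using gram_mult[OF c, of x i] by (simp add: Gx x b_def)
    moreover have "linear (\<lambda>y. g p (G p) (tvec_of A c p y))"
      by (rule linear_metric_tvec_of[OF c GT])
    moreover have "linear (\<lambda>y. \<gamma> p (tvec_of A c p y))"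
    proof (rule linearI)
      show "\<gamma> p (tvec_of A c p (y + z)) = \<gamma> p (tvec_of A c p y) + \<gamma> p (tvec_of A c p z)" for y z
        unfolding tvec_of_linear[OF c] using \<gamma> T unfolding one_form_def by blast
      show "\<gamma> p (tvec_of A c p (a *\<^sub>R y)) = a *\<^sub>R \<gamma> p (tvec_of A c p y)" for a y
        unfolding tvec_of_linear[OF c] real_scaleR_def using \<gamma> T unfolding one_form_def by blast
    qed
    ultimately show ?thesis
      using linear_functional_eqI[OF c v] by blast
  qed
  \<comment> \<open>In a fixed chart \<open>c\<close>, duality makes the components of
    \<open>G\<close> solve the Gram system of \<open>c\<close> itself, whose coefficients are
    smooth, even though \<open>G\<close> was built with \<open>chart_at\<close>.\<close>
  have "smooth_on (range_of c) (comp_in c G)" if c: "c \<in> A" for c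
  proof (rule smooth_on_linear_system[OF open_range_of[OF c]])
    show "smooth_on (range_of c) (\<lambda>x. gram c (param c x) $ i $ j)" for i j
      using metric c unfolding riemannian_metric_def by (simp add: gram_def)
    show "smooth_on (range_of c) (\<lambda>x. b c (param c x) $ i)" for i
      using \<gamma> c unfolding one_form_def by (simp add: b_def)
    fix x assume x: "x \<in> range_of c"
    have cp: "c \<in> charts_at A (param c x)" by (rule charts_at_param[OF c x])
    show "det (gram c (param c x)) \<noteq> 0" by (rule det_gram[OF cp])
    show "gram c (param c x) *v comp_in c G x = b c (param c x)"
      unfolding vec_eq_iff comp_in_def gram_mult[OF cp] tvec_of_components[OF GT cp]
      by (simp add: dual tvec_of_in_tangent_space[OF cp] b_def)
  qed
  then have "G \<in> vector_fields A" using GT by (simp add: vector_fields_def)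
  with dual show ?thesis by blast
qed

text \<open>Existence and uniqueness together give meaning to the definite description in
  \<open>sharp\<close>.\<close>

lemma
  assumes "one_form A \<gamma>"
  shows sharp_in_vector_fields: "sharp A g \<gamma> \<in> vector_fields A"
    and metric_sharp: "v \<in> tangent_space A p \<Longrightarrow> g p (sharp A g \<gamma> p) v = \<gamma> p v"
proof -
  let ?P = "\<lambda>G. G \<in> vector_fields A \<and> (\<forall>p. \<forall>v\<in>tangent_space A p. g p (G p) v = \<gamma> p v)"
  obtain G where G: "?P G"
    using sharp_exists[OF assms] by blast
  have "?P (sharp A g \<gamma>)"
    unfolding sharp_def by (rule theI[of ?P, OF G]) (use G sharp_unique in blast)
  then show "sharp A g \<gamma> \<in> vector_fields A"
    "v \<in> tangent_space A p \<Longrightarrow> g p (sharp A g \<gamma> p) v = \<gamma> p v" by blast+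
qed

section \<open>Pairing of vector fields\<close>

lemma pairing_sym:
  "X \<in> vector_fields A \<Longrightarrow> Y \<in> vector_fields A \<Longrightarrow> pairing g X Y = pairing g Y X"
  by (simp add: pairing_def metric_sym vector_field_tangent fun_eq_iff)

lemma pairing_add:
  "X \<in> vector_fields A \<Longrightarrow> Y \<in> vector_fields A \<Longrightarrow> Z \<in> vector_fields A \<Longrightarrow>
    pairing g (X + Y) Z p = pairing g X Z p + pairing g Y Z p"
  by (simp add: pairing_def metric_add vector_field_tangent)

lemma pairing_vscale:
  "X \<in> vector_fields A \<Longrightarrow> Z \<in> vector_fields A \<Longrightarrow> pairing g (h \<odot> X) Z p = h p * pairing g X Z p"
  by (simp add: pairing_def vscale_def metric_scale vector_field_tangent)

lemma pairing_diff:
  assumes "X \<in> vector_fields A" "Y \<in> vector_fields A" "Z \<in> vector_fields A"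
  shows "pairing g (X - Y) Z p = pairing g X Z p - pairing g Y Z p"
proof -
  have "X - Y = X + (\<lambda>_. -1) \<odot> Y" by (simp add: vscale_def fun_eq_iff)
  show ?thesis
    unfolding \<open>X - Y = _\<close> using assms by (simp add: pairing_add pairing_vscale vector_fields_vscale smooth_fun_const)
qed

lemma vector_fields_diff:
  assumes "X \<in> vector_fields A" "Y \<in> vector_fields A"
  shows "X - Y \<in> vector_fields A"
proof -
  have "X - Y = X + (\<lambda>_. -1) \<odot> Y" by (simp add: vscale_def fun_eq_iff)
  show ?thesis
    unfolding \<open>X - Y = _\<close> using assms by (simp add: vector_fields_add vector_fields_vscale smooth_fun_const)
qed

text \<open>The difference \<open>X - Y\<close> is itself a global field and serves as the test
  field; positive definiteness then makes it vanish at every point.\<close>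

lemma pairing_nondegenerate:
  assumes X: "X \<in> vector_fields A" and Y: "Y \<in> vector_fields A"
    and eq: "\<And>Z. Z \<in> vector_fields A \<Longrightarrow> pairing g X Z = pairing g Y Z"
  shows "X = Y"
proof
  fix p
  have W: "X - Y \<in> vector_fields A" by (rule vector_fields_diff[OF X Y])
  have "pairing g (X - Y) (X - Y) p = 0"
    using pairing_diff[OF X Y W, of p] eq[OF W] by simp
  then have "(X - Y) p = 0"
    using metric_pos[OF vector_field_tangent[OF W] vector_field_tangent[OF W], of p]
    by (force simp: pairing_def)
  then show "X p = Y p" by simp
qed

end

section \<open>Gradients and the soliton equation\<close>

locale gradient_function = riemannian A g
  for A :: "('m::{t2_space, second_countable_topology}, 'n::finite) chart set"
    and g +
  fixes f :: "'m \<Rightarrow> real" and nabla :: "('m, 'n) connection"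
  assumes smooth: "smooth_fun A f" and connection: "levi_civita A g nabla"
begin

abbreviation "\<xi> \<equiv> grad A g f"

section \<open>The Levi-Civita connection and the Hessian\<close>

lemma nabla_in_vector_fields:
  "X \<in> vector_fields A \<Longrightarrow> Y \<in> vector_fields A \<Longrightarrow> nabla X Y \<in> vector_fields A"
  using connection smooth unfolding levi_civita_def affine_connection_def by blast

lemma torsion_free:
  "X \<in> vector_fields A \<Longrightarrow> Y \<in> vector_fields A \<Longrightarrow> bracket A X Y = nabla X Y - nabla Y X"
  using connection unfolding levi_civita_def by simp

lemma metric_compatible:
  assumes "X \<in> vector_fields A" "Y \<in> vector_fields A" "Z \<in> vector_fields A"
  shows "deriv_along A X (pairing g Y Z) p = pairing g (nabla X Y) Z p + pairing g Y (nabla X Z) p"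
proof -
  have "deriv_along A X (pairing g Y Z) = pairing g (nabla X Y) Z + pairing g Y (nabla X Z)"
    using assms connection unfolding levi_civita_def by blast
  then show ?thesis by simp
qed

lemma grad_in_vector_fields: "\<xi> \<in> vector_fields A"
  unfolding grad_def by (intro sharp_in_vector_fields one_form_differential smooth)

lemma pairing_grad: "X \<in> vector_fields A \<Longrightarrow> pairing g \<xi> X p = differential A f p (X p)"
  unfolding grad_def pairing_def
  by (intro metric_sharp one_form_differential smooth vector_field_tangent)

text \<open>Metric compatibility gives \<open>X (Y f) - (nabla X Y) f\<close> for the left-hand
  side. Exchanging \<open>X\<close> and \<open>Y\<close> changes this by a commutator and a bracket
  term, which cancel because the torsion vanishes.\<close>

lemma hessian_symmetric:
  assumes X: "X \<in> vector_fields A" and Y: "Y \<in> vector_fields A"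
  shows "pairing g (nabla X \<xi>) Y p = pairing g (nabla Y \<xi>) X p"
proof -
  have hess: "pairing g (nabla X \<xi>) Y p
      = deriv_along A X (deriv_along A Y f) p - differential A f p (nabla X Y p)"
    if X: "X \<in> vector_fields A" and Y: "Y \<in> vector_fields A" for X Y
  proof -
    have "pairing g \<xi> Y = deriv_along A Y f"
      by (rule ext) (simp add: pairing_grad Y deriv_along_def)
    then show ?thesis
      using metric_compatible[OF X grad_in_vector_fields Y, of p]
        pairing_grad[OF nabla_in_vector_fields[OF X Y], of p] by simp
  qed
  have "differential A f p (nabla X Y p) - differential A f p (nabla Y X p)
      = deriv_along A (bracket A X Y) f p"
    by (simp add: torsion_free X Y deriv_along_def linear_differential(2)[OF smooth])
  then show ?thesis
    unfolding hess[OF X Y] hess[OF Y X] deriv_along_bracket[OF smooth X Y] by linarith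
qed

text \<open>With brackets expressed through \<open>nabla\<close>, the terms differentiating along
  \<xi> cancel. The two remaining terms are equal by symmetry of the Hessian.\<close>

lemma lie_metric_grad:
  assumes X: "X \<in> vector_fields A" and Y: "Y \<in> vector_fields A"
  shows "lie_metric A g \<xi> X Y p = 2 * pairing g (nabla X \<xi>) Y p"
proof -
  note \<xi> = grad_in_vector_fields
  have 1: "pairing g (bracket A \<xi> X) Y p = pairing g (nabla \<xi> X) Y p - pairing g (nabla X \<xi>) Y p"
    using X Y \<xi> by (simp add: torsion_free pairing_diff nabla_in_vector_fields)
  have "pairing g (bracket A \<xi> Y) X p = pairing g (nabla \<xi> Y) X p - pairing g (nabla Y \<xi>) X p"
    using X Y \<xi> by (simp add: torsion_free pairing_diff nabla_in_vector_fields)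
  then have 2: "pairing g X (bracket A \<xi> Y) p
      = pairing g X (nabla \<xi> Y) p - pairing g (nabla X \<xi>) Y p"
    using X Y \<xi> hessian_symmetric[OF X Y, of p]
    by (simp add: pairing_sym[of X] torsion_free vector_fields_diff nabla_in_vector_fields)
  show ?thesis
    unfolding lie_metric_def minus_apply metric_compatible[OF \<xi> X Y] 1 2 by simp
qed

end

locale gradient_soliton = gradient_function A g f nabla
  for A :: "('m::{t2_space, second_countable_topology}, 'n::finite) chart set"
    and g f nabla +
  fixes lam mu :: real
  assumes soliton: "gradient_eta_ricci_soliton A g nabla f lam mu"
begin

section \<open>Consequences of the soliton equation\<close>

lemma ricci_eq:
  assumes X: "X \<in> vector_fields A" and Y: "Y \<in> vector_fields A"
  shows "ricci A nabla X Y p = - pairing g (nabla X \<xi>) Y p - lam * pairing g X Y p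
    - mu * pairing g \<xi> X p * pairing g \<xi> Y p"
proof -
  have "lie_metric A g \<xi> X Y p + 2 * ricci A nabla X Y p + 2 * lam * pairing g X Y p
      + 2 * mu * differential A f p (X p) * differential A f p (Y p) = 0"
    using soliton X Y unfolding gradient_eta_ricci_soliton_def by blast
  then show ?thesis
    unfolding lie_metric_grad[OF X Y] by (simp add: pairing_grad X Y)
qed

text \<open>The soliton equation exhibits the vector field dual to \<open>S(X, \<cdot>)\<close>, so that neither the
  tensoriality nor the symmetry of the Ricci tensor has to be derived from its definition.\<close>

lemma
  assumes X: "X \<in> vector_fields A"
  shows ricci_op_in_vector_fields: "ricci_op A g nabla X \<in> vector_fields A"
    and pairing_ricci_op:
      "Y \<in> vector_fields A \<Longrightarrow> pairing g (ricci_op A g nabla X) Y = ricci A nabla X Y"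
    and soliton_vector_equation:
      "nabla X \<xi> + ricci_op A g nabla X + (\<lambda>_. lam) \<odot> X = (\<lambda>p. - (mu * pairing g \<xi> X p)) \<odot> \<xi>"
proof -
  \<comment> \<open>Identifying the coefficient with a multiple of \<open>X f\<close> shows that it
    is smooth, so that its product with \<xi> is a vector field.\<close>
  have "pairing g \<xi> X = deriv_along A X f"
    by (rule ext) (simp add: pairing_grad X deriv_along_def)
  then have "smooth_fun A (\<lambda>p. - (mu * pairing g \<xi> X p))"
    using smooth_fun_cmult[OF smooth_fun_deriv_along[OF smooth X], of "- mu"] by simp
  then have V: "(\<lambda>p. - (mu * pairing g \<xi> X p)) \<odot> \<xi> \<in> vector_fields A" (is "?V \<in> _")
    by (rule vector_fields_vscale[OF _ grad_in_vector_fields])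
  have N: "nabla X \<xi> \<in> vector_fields A" by (rule nabla_in_vector_fields[OF X grad_in_vector_fields])
  have L: "(\<lambda>_. lam) \<odot> X \<in> vector_fields A" by (rule vector_fields_vscale[OF smooth_fun_const X])
  let ?W = "?V - nabla X \<xi> - (\<lambda>_. lam) \<odot> X"
  have W: "?W \<in> vector_fields A" by (intro vector_fields_diff V N L)
  have dual: "pairing g ?W Y = ricci A nabla X Y" if Y: "Y \<in> vector_fields A" for Y
    by (rule ext)
      (simp add: pairing_diff vector_fields_diff pairing_vscale V N L X Y grad_in_vector_fields ricci_eq)
  have "ricci_op A g nabla X = ?W"
    unfolding ricci_op_def
    \<comment> \<open>Uniqueness of the field described by \<open>ricci_op\<close> is nondegeneracy
      of the pairing on vector fields.\<close>
    by (rule the_equality) (use W dual pairing_nondegenerate in auto)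
  with W dual show "ricci_op A g nabla X \<in> vector_fields A"
    "Y \<in> vector_fields A \<Longrightarrow> pairing g (ricci_op A g nabla X) Y = ricci A nabla X Y"
    "nabla X \<xi> + ricci_op A g nabla X + (\<lambda>_. lam) \<odot> X = ?V"
    by simp_all
qed

lemma orthogonal_iff:
  assumes X: "X \<in> vector_fields A" and "mu \<noteq> 0"
  shows "(\<forall>p. pairing g X \<xi> p = 0) \<longleftrightarrow>
    nabla X \<xi> + ricci_op A g nabla X + (\<lambda>_. lam) \<odot> X = 0"
proof -
  note \<xi> = grad_in_vector_fields
  have "(\<forall>p. pairing g \<xi> X p = 0) \<longleftrightarrow> (\<lambda>p. - (mu * pairing g \<xi> X p)) \<odot> \<xi> = 0"
  proof
    assume 0: "(\<lambda>p. - (mu * pairing g \<xi> X p)) \<odot> \<xi> = 0"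
    show "\<forall>p. pairing g \<xi> X p = 0"
    proof (rule allI, rule ccontr)
      fix p assume nz: "pairing g \<xi> X p \<noteq> 0"
      \<comment> \<open>Where the scalar is nonzero it can be cancelled, which forces \<xi> to
        vanish at \<open>p\<close> and with it the pairing: a contradiction at that single
        point.\<close>
      have "(- (mu * pairing g \<xi> X p)) *\<^sub>R \<xi> p c = 0" for c
        using fun_cong[OF fun_cong[OF 0], of p c] by (simp add: vscale_def)
      then have "\<xi> p = 0" using nz \<open>mu \<noteq> 0\<close> by (simp add: fun_eq_iff)
      then have "pairing g \<xi> X p = 0"
        by (simp add: pairing_def metric_zero vector_field_tangent X)
      with nz show False by contradiction
    qed
  qed (simp add: vscale_def fun_eq_iff)
  then show ?thesis
    unfolding soliton_vector_equation[OF X] by (simp add: pairing_sym[OF X \<xi>])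
qed

text \<open>In the formula for the Ricci tensor on \<xi> and \<open>X\<close>, the terms with
  \<open>lam\<close> and \<open>mu\<close> both carry the factor \<open>pairing g \<xi> X p\<close>,
  which is zero. The Hessian term left over is, by symmetry,
  \<open>pairing g (nabla X \<xi>) \<xi> p\<close>, half the derivative of the squared norm of \<xi>
  along \<open>X\<close>.\<close>

lemma deriv_along_norm_grad:
  assumes X: "X \<in> vector_fields A" and orth: "pairing g X \<xi> p = 0"
  shows "1 / 2 * deriv_along A X (pairing g \<xi> \<xi>) p = - pairing g X (ricci_op A g nabla \<xi>) p"
proof -
  note \<xi> = grad_in_vector_fields
  have "pairing g \<xi> X p = 0" using orth by (simp add: pairing_sym[OF X \<xi>])
  have "pairing g X (ricci_op A g nabla \<xi>) p = ricci A nabla \<xi> X p"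
    by (simp add: pairing_sym[OF X ricci_op_in_vector_fields[OF \<xi>]] pairing_ricci_op \<xi> X)
  also have "\<dots> = - pairing g (nabla X \<xi>) \<xi> p"
    using ricci_eq[OF \<xi> X, of p] hessian_symmetric[OF \<xi> X, of p] \<open>pairing g \<xi> X p = 0\<close> by simp
  also have "2 * pairing g (nabla X \<xi>) \<xi> p = deriv_along A X (pairing g \<xi> \<xi>) p"
    using metric_compatible[OF X \<xi> \<xi>, of p]
      pairing_sym[OF \<xi> nabla_in_vector_fields[OF X \<xi>]] by simp
  then have "pairing g (nabla X \<xi>) \<xi> p = 1 / 2 * deriv_along A X (pairing g \<xi> \<xi>) p"
    by simp
  finally show ?thesis by simp
qed

end

theorem proposition3p8:
  fixes A :: "('m::{t2_space, second_countable_topology}, 'n::finite) chart set"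
    and g :: "('m, 'n) metric"
    and nabla :: "('m, 'n) connection"
    and f :: "'m \<Rightarrow> real"
    and lam mu :: real
    and \<gamma> \<eta> :: "('m, 'n) form1"
    and \<xi> :: "('m, 'n) vfield"
  assumes dim: "CARD('n) > 2"
    and manifold: "smooth_manifold A"
    and metric: "riemannian_metric A g"
    and connection: "levi_civita A g nabla"
    and smooth: "smooth_fun A f"
    and xi: "\<xi> = grad A g f"
    and eta: "\<eta> = differential A f"
    and soliton: "gradient_eta_ricci_soliton A g nabla f lam mu"
    and mu_nonzero: "mu \<noteq> 0"
    and form: "one_form A \<gamma>"
  shows "(orthogonal_forms A g \<gamma> \<eta> \<longleftrightarrow>
           nabla (sharp A g \<gamma>) \<xi> + ricci_op A g nabla (sharp A g \<gamma>)
             + (\<lambda>_. lam) \<odot> sharp A g \<gamma> = 0) \<and>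
         (orthogonal_forms A g \<gamma> \<eta> \<longrightarrow>
           (\<forall>p. 1 / 2 * deriv_along A (sharp A g \<gamma>) (pairing g \<xi> \<xi>) p
                = - \<gamma> p (ricci_op A g nabla \<xi> p)))"
proof -
  interpret gradient_soliton A g f nabla lam mu
    using manifold metric connection smooth soliton by unfold_locales
  note G = sharp_in_vector_fields[OF form]
  \<comment> \<open>The dual of \<eta> is the gradient \<xi> by definition, so orthogonality of
    forms becomes orthogonality of fields.\<close>
  have orth: "orthogonal_forms A g \<gamma> \<eta> \<longleftrightarrow> (\<forall>p. pairing g (sharp A g \<gamma>) \<xi> p = 0)"
    by (simp add: orthogonal_forms_def xi eta grad_def)
  \<comment> \<open>The defining property of the dual field turns evaluation of \<gamma> into a
    pairing, the form in which the derivative formula is available.\<close>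
  have "\<gamma> p (ricci_op A g nabla \<xi> p) = pairing g (sharp A g \<gamma>) (ricci_op A g nabla \<xi>) p" for p
    using metric_sharp[OF form]
      vector_field_tangent[OF ricci_op_in_vector_fields[OF grad_in_vector_fields]]
    by (simp add: xi pairing_def)
  then show ?thesis
    using orthogonal_iff[OF G mu_nonzero] deriv_along_norm_grad[OF G]
    unfolding orth xi by (metis (no_types))
qed

end
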